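(* If $w,w'\in W^s_0$ and $d(\widetilde w,\widetilde w')=0$, then $\widetilde w=\widetilde w'$. Consequently $d$ is a metric on $\mathcal G_0$.
   Context: Fix a countably infinite vertex set $V=\{v_1,v_2,v_3,\dots\}$ and let $E$ be the set of all 2-element subsets of $V$ (write $uv$ for $\{u,v\}$). A labeled graph is a function $w:E\to\mathbb R$; $W$ is the set (vector space) of all labeled graphs. An edge $e$ is nonzero in $w$ if $w(e)\ne 0$; a vertex is isolated in $w$ if no nonzero edge of $w$ contains it. $w$ is standard if it has infinitely many isolated vertices; $W^s$ is the set of standard labeled graphs. For $w,w'\in W$ put $|w|=\sum_{e\in E}|w(e)|\in[0,\infty]$ and $d(w,w')=|w-w'|$; $W_0=\{w\in W: |w|<\infty\}$ and $W^s_0=W_0\cap W^s$. $w\sim w'$ (isomorphic) means there is a bijection $f:V\to V$ with $w(uv)=w'(f(u)f(v))$ for all $uv\in E$. $\widetilde w$ is the equivalence class of $w$ under $\sim$; $\mathcal G=W^s/\sim$ and $\mathcal G_0=W^s_0/\sim$ are the sets of unlabeled graphs (respectively, unlabeled graphs of finite norm). For $G,G'\in\mathcal G$, $d(G,G')=\inf\{d(w,w') : w\in G,\ w'\in G'\}$. *)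

theory Defs
  imports "HOL-Analysis.Analysis" "HOL-Library.Infinite_Typeclass"
begin

text \<open>
  The vertices are the elements of a type \<open>'v\<close>, which is countably infinite when
  \<open>'v :: {countable, infinite}\<close>.
\<close>

definition edges :: "'v set set" where
  "edges = {e. card e = 2}"

text \<open>
  A function \<open>edges \<rightarrow> \<real>\<close> is represented by its extensional version, so that equality of
  labeled graphs is equality of their restrictions to \<open>edges\<close>.
\<close>

type_synonym 'v lgraph = "'v set \<Rightarrow> real"

definition lgraphs :: "'v lgraph set" where
  "lgraphs = edges \<rightarrow>\<^sub>E UNIV"

definition isolated :: "'v lgraph \<Rightarrow> 'v \<Rightarrow> bool" where
  "isolated w v \<longleftrightarrow> \<not> (\<exists>e\<in>edges. w e \<noteq> 0 \<and> v \<in> e)"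

definition std_lgraphs :: "'v lgraph set" where
  "std_lgraphs = {w \<in> lgraphs. infinite {v. isolated w v}}"

definition lnorm :: "'v lgraph \<Rightarrow> ennreal" where
  "lnorm w = (\<Sum>\<^sub>\<infinity>e\<in>edges. ennreal \<bar>w e\<bar>)"

definition ldist :: "'v lgraph \<Rightarrow> 'v lgraph \<Rightarrow> ennreal" where
  "ldist w w' = lnorm (\<lambda>e\<in>edges. w e - w' e)"

definition fin_lgraphs :: "'v lgraph set" where
  "fin_lgraphs = {w \<in> lgraphs. lnorm w < \<infinity>}"

definition fin_std_lgraphs :: "'v lgraph set" where
  "fin_std_lgraphs = fin_lgraphs \<inter> std_lgraphs"

definition iso_rel :: "'v lgraph rel" where
  "iso_rel = {(w, w'). w \<in> lgraphs \<and> w' \<in> lgraphs \<and>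
     (\<exists>f :: 'v \<Rightarrow> 'v. bij f \<and> (\<forall>u v. {u, v} \<in> edges \<longrightarrow> w {u, v} = w' {f u, f v}))}"

definition iso_class :: "'v lgraph \<Rightarrow> 'v lgraph set" where
  "iso_class w = iso_rel `` {w}"

definition ugraphs :: "'v lgraph set set" where
  "ugraphs = std_lgraphs // iso_rel"

definition fin_ugraphs :: "'v lgraph set set" where
  "fin_ugraphs = fin_std_lgraphs // iso_rel"

definition udist :: "'v lgraph set \<Rightarrow> 'v lgraph set \<Rightarrow> ennreal" where
  "udist G G' = Inf {ldist w w' | w w'. w \<in> G \<and> w' \<in> G'}"

lemma pair_in_edges: "{u, v} \<in> edges \<longleftrightarrow> u \<noteq> v"
  by (auto simp: edges_def card_insert_if)

lemma equiv_iso_rel: "equiv lgraphs iso_rel"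
proof (rule equivI)
  show "iso_rel \<subseteq> lgraphs \<times> lgraphs"
    by (auto simp: iso_rel_def)
  show "refl_on lgraphs iso_rel"
    by (auto simp: iso_rel_def refl_on_def intro!: exI[of _ id])
  show "sym iso_rel"
  proof (rule symI)
    fix w w' :: "'v lgraph"
    assume "(w, w') \<in> iso_rel"
    then obtain f where f: "w \<in> lgraphs" "w' \<in> lgraphs" "bij f"
        "\<And>u v. u \<noteq> v \<Longrightarrow> w {u, v} = w' {f u, f v}"
      by (auto simp: iso_rel_def pair_in_edges)
    have "w' {u, v} = w {inv f u, inv f v}" if "u \<noteq> v" for u v
      using f(3) f(4)[of "inv f u" "inv f v"] that
      by (simp add: bij_is_surj surj_f_inv_f) (metis bij_is_surj surj_f_inv_f)
    then show "(w', w) \<in> iso_rel"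
      using f by (auto simp: iso_rel_def pair_in_edges bij_imp_bij_inv intro!: exI[of _ "inv f"])
  qed
  show "trans iso_rel"
  proof (rule transI)
    fix w w' w'' :: "'v lgraph"
    assume "(w, w') \<in> iso_rel" "(w', w'') \<in> iso_rel"
    then obtain f g where fg: "w \<in> lgraphs" "w'' \<in> lgraphs" "bij f" "bij g"
        "\<And>u v. u \<noteq> v \<Longrightarrow> w {u, v} = w' {f u, f v}"
        "\<And>u v. u \<noteq> v \<Longrightarrow> w' {u, v} = w'' {g u, g v}"
      by (auto simp: iso_rel_def pair_in_edges)
    have "w {u, v} = w'' {(g \<circ> f) u, (g \<circ> f) v}" if "u \<noteq> v" for u v
      using fg(5)[OF that] fg(6)[of "f u" "f v"] that fg(3)
      by (simp add: bij_is_inj inj_eq)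
    then show "(w, w'') \<in> iso_rel"
      using fg(1-4) bij_comp[of f g]
      unfolding iso_rel_def pair_in_edges by blast
  qed
qed

end

theory Submission
  imports Defs "HOL-Library.Diagonal_Subsequence"
begin

text \<open>
  The distance of two unlabeled graphs is the infimum of \<open>ldist w (relabel f w')\<close> over all
  bijections \<open>f\<close>, for any choice of representatives \<open>w\<close>, \<open>w'\<close> (\<open>udist_iso_class\<close>), because
  relabeling both arguments of \<open>ldist\<close> changes nothing. Symmetry, finiteness and the triangle
  inequality follow from those of the norm. The substance is that distance \<open>0\<close> forces
  isomorphism (\<open>iso_rel_if_udist_0\<close>): the infimum has to be attained, although there is no
  reason for the almost optimal bijections to converge on all of the vertex set.

  They do converge, after passing to a subsequence, at the vertices that matter. Take bijections
  \<open>F n\<close> for which \<open>ldist w (relabel (F n) w')\<close> tends to \<open>0\<close>. If \<open>v\<close> lies on an edge \<open>e\<close> with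
  \<open>w e \<noteq> 0\<close>, then for large \<open>n\<close> the edge \<open>F n ` e\<close> has weight more than \<open>\<bar>w e\<bar> / 2\<close> in \<open>w'\<close>.
  A graph of finite norm has only finitely many such edges, so \<open>F n v\<close> takes finitely many values
  (\<open>finite_range_of_nonisolated\<close>). The roles of \<open>w\<close> and \<open>w'\<close> can be exchanged by inverting
  \<open>F n\<close>. By countability of the vertex set a diagonal argument
  (\<open>diagonal_eventually_constant\<close>) gives one subsequence along which \<open>F n v\<close> is eventually equal
  to some \<open>f v\<close> for every nonisolated \<open>v\<close> of \<open>w\<close>, and \<open>inv (F n) v\<close> to some \<open>g v\<close> for every
  nonisolated \<open>v\<close> of \<open>w'\<close>. The limits \<open>f\<close> and \<open>g\<close> are mutually inverse and preserve weights.

  It remains to extend \<open>f\<close> to the isolated vertices (\<open>iso_of_nonisolated_bij\<close>). This is where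
  standardness enters: both graphs have countably infinitely many isolated vertices, and any
  bijection between these two sets will do.
\<close>

section \<open>Relabelings\<close>

definition relabel :: "('v \<Rightarrow> 'v) \<Rightarrow> 'v lgraph \<Rightarrow> 'v lgraph" where
  "relabel f w = (\<lambda>e\<in>edges. w (f ` e))"

lemma relabel_in_lgraphs [simp]: "relabel f w \<in> lgraphs"
  by (auto simp: relabel_def lgraphs_def)

lemma relabel_apply [simp]: "e \<in> edges \<Longrightarrow> relabel f w e = w (f ` e)"
  by (simp add: relabel_def)

lemma image_in_edges_iff: "inj f \<Longrightarrow> f ` e \<in> edges \<longleftrightarrow> e \<in> edges"
  by (simp add: edges_def card_image inj_on_subset[of f UNIV])

lemma edgeE:
  assumes "e \<in> edges" "v \<in> e"
  obtains u where "e = {v, u}" "u \<noteq> v"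
  using assms by (auto simp: edges_def card_2_iff)

lemma relabel_relabel: "inj f \<Longrightarrow> relabel f (relabel g w) = relabel (g \<circ> f) w"
  by (rule ext) (simp add: relabel_def image_in_edges_iff image_comp)

lemma relabel_inv_cancel:
  assumes "bij f" "w \<in> lgraphs"
  shows "relabel f (relabel (inv f) w) = w" "relabel (inv f) (relabel f w) = w"
proof -
  have "relabel id w = w"
    using assms(2) by (auto simp: relabel_def lgraphs_def)
  then show "relabel f (relabel (inv f) w) = w" "relabel (inv f) (relabel f w) = w"
    using assms(1)
    by (simp_all add: relabel_relabel bij_is_inj bij_is_surj bij_imp_bij_inv
        surj_iff[THEN iffD1])
qed

lemma lgraphs_eqI:
  assumes "w \<in> lgraphs" "w' \<in> lgraphs" "\<And>u v. u \<noteq> v \<Longrightarrow> w {u, v} = w' {u, v}"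
  shows "w = w'"
proof (rule PiE_ext[of _ edges "\<lambda>_. UNIV"])
  show "w e = w' e" if "e \<in> edges" for e
    using that assms(3) by (auto simp: edges_def card_2_iff)
qed (use assms in \<open>auto simp: lgraphs_def\<close>)

text \<open>
  Working with \<open>relabel\<close> instead of the pairs \<open>{u, v}\<close> turns isomorphism into an equation between
  functions, to which composition and inversion of bijections apply directly.
\<close>

lemma iso_rel_iff_relabel:
  "(w, w') \<in> iso_rel \<longleftrightarrow> w \<in> lgraphs \<and> w' \<in> lgraphs \<and> (\<exists>f. bij f \<and> w = relabel f w')"
proof -
  have "(\<forall>u v. {u, v} \<in> edges \<longrightarrow> w {u, v} = w' {f u, f v}) \<longleftrightarrow> w = relabel f w'"
    if "w \<in> lgraphs" for f
    using lgraphs_eqI[OF that, of "relabel f w'"] by (auto simp: pair_in_edges)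
  then show ?thesis by (auto simp: iso_rel_def)
qed

section \<open>The norm\<close>

lemma ennreal_summable_on [simp]: "(f :: 'a \<Rightarrow> ennreal) summable_on A"
  by (rule nonneg_summable_on_complete) simp

lemma ldist_eq: "ldist w w' = (\<Sum>\<^sub>\<infinity>e\<in>edges. ennreal \<bar>w e - w' e\<bar>)"
  unfolding ldist_def lnorm_def by (rule infsum_cong) simp

lemma ldist_self [simp]: "ldist w w = 0"
  by (simp add: ldist_eq)

lemma ldist_commute: "ldist w w' = ldist w' w"
  by (simp add: ldist_eq abs_minus_commute)

lemma ldist_triangle: "ldist w w'' \<le> ldist w w' + ldist w' w''"
proof -
  have "ldist w w'' \<le> (\<Sum>\<^sub>\<infinity>e\<in>edges. ennreal \<bar>w e - w' e\<bar> + ennreal \<bar>w' e - w'' e\<bar>)"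
    unfolding ldist_eq by (rule infsum_mono) (auto simp flip: ennreal_plus intro!: ennreal_leI)
  then show ?thesis by (simp add: ldist_eq infsum_add)
qed

lemma ldist_le_lnorms: "ldist w w' \<le> lnorm w + lnorm w'"
proof -
  have "ldist w w' \<le> (\<Sum>\<^sub>\<infinity>e\<in>edges. ennreal \<bar>w e\<bar> + ennreal \<bar>w' e\<bar>)"
    unfolding ldist_eq by (rule infsum_mono) (auto simp flip: ennreal_plus intro!: ennreal_leI)
  then show ?thesis by (simp add: lnorm_def infsum_add)
qed

lemma ldist_relabel:
  assumes "bij f"
  shows "ldist (relabel f w) (relabel f w') = ldist w w'"
proof -
  have "bij_betw ((`) f) edges edges"
  proof (rule bij_betw_byWitness[where f' = "(`) (inv f)"])
    show "(`) f ` edges \<subseteq> edges" "(`) (inv f) ` edges \<subseteq> edges"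
      using assms by (auto simp: image_in_edges_iff bij_is_inj bij_imp_bij_inv)
  qed (use assms in \<open>auto simp: image_comp bij_is_inj bij_is_surj surj_f_inv_f\<close>)
  from infsum_reindex_bij_betw[OF this, of "\<lambda>e. ennreal \<bar>w e - w' e\<bar>"]
  show ?thesis by (simp add: ldist_eq cong: infsum_cong)
qed

text \<open>
  The symmetry that lets every statement about \<open>F n\<close>, \<open>w\<close>, \<open>w'\<close> be reused for
  \<open>inv (F n)\<close>, \<open>w'\<close>, \<open>w\<close>.
\<close>

lemma ldist_relabel_inv:
  assumes "bij f" "w \<in> lgraphs"
  shows "ldist w' (relabel (inv f) w) = ldist w (relabel f w')"
  using ldist_relabel[OF assms(1), of "relabel (inv f) w" w'] relabel_inv_cancel[OF assms]
  by (simp add: ldist_commute)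

lemma edge_diff_le_ldist:
  assumes "e \<in> edges"
  shows "ennreal \<bar>w e - w' e\<bar> \<le> ldist w w'"
proof -
  have "infsum (\<lambda>e. ennreal \<bar>w e - w' e\<bar>) {e} \<le> ldist w w'"
    unfolding ldist_eq by (rule infsum_mono_neutral) (use assms in auto)
  then show ?thesis by simp
qed

text \<open>
  Infinitely many edges of weight at least \<open>\<delta>\<close> would make the norm infinite. This is the only
  way in which finiteness of the norm enters the convergence argument.
\<close>

lemma finite_heavy_edges:
  assumes "w \<in> fin_lgraphs" "\<delta> > 0"
  shows "finite {e \<in> edges. \<bar>w e\<bar> \<ge> \<delta>}" (is "finite ?S")
proof (rule ccontr)
  assume "infinite ?S"
  then have "infsum (\<lambda>e. ennreal \<bar>w e\<bar>) ?S = \<infinity>"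
    using assms(2) by (intro infsum_superconst_infinite_ennreal[of _ "ennreal \<delta>"]) (auto intro: ennreal_leI)
  moreover have "infsum (\<lambda>e. ennreal \<bar>w e\<bar>) ?S \<le> lnorm w"
    unfolding lnorm_def by (rule infsum_mono_neutral) auto
  ultimately show False using assms(1) by (simp add: fin_lgraphs_def top_unique)
qed

section \<open>The distance of unlabeled graphs\<close>

text \<open>
  Applying the same bijection to both graphs preserves their distance, so one of the two
  representatives can be kept fixed, and only the relative bijection varies.
\<close>

lemma udist_iso_class:
  assumes w: "w \<in> lgraphs" and w': "w' \<in> lgraphs"
  shows "udist (iso_class w) (iso_class w') = (INF f\<in>{f. bij f}. ldist w (relabel f w'))"
proof (rule antisym)
  show "udist (iso_class w) (iso_class w') \<le> (INF f\<in>{f. bij f}. ldist w (relabel f w'))"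
  proof (rule INF_greatest)
    fix f :: "'a \<Rightarrow> 'a" assume "f \<in> {f. bij f}"
    then have f: "bij f" by simp
    have "relabel f w' \<in> iso_class w'"
      using relabel_inv_cancel(2)[OF f w'] bij_imp_bij_inv[OF f] w'
      by (auto simp: iso_class_def iso_rel_iff_relabel intro!: exI[of _ "inv f"])
    moreover have "w \<in> iso_class w"
      using equiv_class_self[OF equiv_iso_rel w] by (simp add: iso_class_def)
    ultimately show "udist (iso_class w) (iso_class w') \<le> ldist w (relabel f w')"
      unfolding udist_def by (intro Inf_lower) auto
  qed
next
  show "(INF f\<in>{f. bij f}. ldist w (relabel f w')) \<le> udist (iso_class w) (iso_class w')"
    unfolding udist_def
  proof (rule Inf_greatest, clarify)
    fix w1 w1' assume "w1 \<in> iso_class w" "w1' \<in> iso_class w'"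
    then obtain f g where f: "bij f" "w = relabel f w1" and g: "bij g" "w' = relabel g w1'"
      and w1: "w1' \<in> lgraphs"
      by (auto simp: iso_class_def iso_rel_iff_relabel)
    have "ldist w1 w1' = ldist w (relabel f w1')"
      using f by (simp add: ldist_relabel)
    also have "relabel f w1' = relabel (inv g \<circ> f) w'"
      using relabel_inv_cancel(2)[OF g(1) w1] g(2) f(1) by (metis bij_is_inj relabel_relabel)
    finally show "(INF f\<in>{f. bij f}. ldist w (relabel f w')) \<le> ldist w1 w1'"
      using bij_comp[OF f(1) bij_imp_bij_inv[OF g(1)]] by (auto intro: INF_lower)
  qed
qed

lemma udist_commute: "udist G G' = udist G' G"
  unfolding udist_def by (rule arg_cong[of _ _ Inf]) (use ldist_commute in blast)

text \<open>
  Almost optimal bijections \<open>f\<close> from \<open>w\<close> to \<open>w'\<close> and \<open>g\<close> from \<open>w'\<close> to \<open>w''\<close> compose to a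
  bijection from \<open>w\<close> to \<open>w''\<close>; the second leg, \<open>relabel f w'\<close> to
  \<open>relabel f (relabel g w'')\<close>, is as long as that from \<open>w'\<close> to \<open>relabel g w''\<close>.
\<close>

lemma udist_triangle:
  assumes w: "w \<in> lgraphs" "w' \<in> lgraphs" "w'' \<in> lgraphs"
  shows "udist (iso_class w) (iso_class w'')
      \<le> udist (iso_class w) (iso_class w') + udist (iso_class w') (iso_class w'')"
    (is "?x \<le> ?a + ?b")
proof (rule ennreal_le_epsilon)
  fix \<epsilon> :: real assume fin: "?a + ?b < top" and "\<epsilon> > 0"
  \<comment> \<open>The infima need not be attained, so half of \<open>\<epsilon>\<close> is spent on each.\<close>
  have "?a < ?a + ennreal (\<epsilon> / 2)" "?b < ?b + ennreal (\<epsilon> / 2)"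
    using fin \<open>\<epsilon> > 0\<close> by (auto simp: ennreal_zero_less_divide)
  then obtain f g where f: "bij f" "ldist w (relabel f w') < ?a + ennreal (\<epsilon> / 2)"
    and g: "bij g" "ldist w' (relabel g w'') < ?b + ennreal (\<epsilon> / 2)"
    unfolding udist_iso_class[OF w(1,2)] udist_iso_class[OF w(2,3)] INF_less_iff by auto
  have "?x \<le> ldist w (relabel (g \<circ> f) w'')"
    using bij_comp[OF f(1) g(1)] by (auto simp: udist_iso_class w intro: INF_lower)
  also have "\<dots> \<le> ldist w (relabel f w') + ldist (relabel f w') (relabel f (relabel g w''))"
    using ldist_triangle by (simp add: relabel_relabel bij_is_inj f(1))
  also have "\<dots> \<le> (?a + ennreal (\<epsilon> / 2)) + (?b + ennreal (\<epsilon> / 2))"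
    using f g by (intro add_mono) (auto simp: ldist_relabel)
  also have "\<dots> = ?a + ?b + (ennreal (\<epsilon> / 2) + ennreal (\<epsilon> / 2))"
    by (simp add: ac_simps)
  also have "ennreal (\<epsilon> / 2) + ennreal (\<epsilon> / 2) = ennreal \<epsilon>"
    using \<open>\<epsilon> > 0\<close> by (simp flip: ennreal_plus)
  finally show "?x \<le> ?a + ?b + ennreal \<epsilon>" .
qed

lemma udist_le_ldist:
  assumes "w \<in> lgraphs" "w' \<in> lgraphs"
  shows "udist (iso_class w) (iso_class w') \<le> ldist w w'"
  using equiv_class_self[OF equiv_iso_rel] assms
  unfolding udist_def iso_class_def by (intro Inf_lower) auto

lemma udist_self: "w \<in> lgraphs \<Longrightarrow> udist (iso_class w) (iso_class w) = 0"
  using udist_le_ldist[of w w] by simp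

lemma udist_finite:
  assumes "w \<in> fin_lgraphs" "w' \<in> fin_lgraphs"
  shows "udist (iso_class w) (iso_class w') < \<infinity>"
proof -
  have "udist (iso_class w) (iso_class w') \<le> ldist w w'"
    using assms by (intro udist_le_ldist) (auto simp: fin_lgraphs_def)
  also have "\<dots> \<le> lnorm w + lnorm w'" by (rule ldist_le_lnorms)
  also have "\<dots> < \<infinity>" using assms by (simp add: fin_lgraphs_def)
  finally show ?thesis .
qed

section \<open>Limits of relabelings\<close>

text \<open>
  For a single sequence with finite range the pigeonhole principle gives a constant subsequence;
  diagonalization over the countable index type then serves all the sequences at once.
\<close>

lemma diagonal_eventually_constant:
  fixes a :: "'i::countable \<Rightarrow> nat \<Rightarrow> 'b"
  assumes "\<And>i. i \<in> I \<Longrightarrow> finite (range (a i))"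
  shows "\<exists>s c. strict_mono s \<and> (\<forall>i\<in>I. \<forall>\<^sub>F k in sequentially. a i (s k) = c i)"
proof -
  define P where "P n s \<longleftrightarrow> (from_nat n \<in> I \<longrightarrow> (\<exists>c. \<forall>k. a (from_nat n) (s k) = c))"
    for n and s :: "nat \<Rightarrow> nat"
  \<comment> \<open>Constancy from the start passes to subsequences, as diagonalization needs; the diagonal
    sequence is only guaranteed to be constant from index \<open>n + 1\<close> on, hence the eventuality.\<close>
  interpret subseqs P
  proof
    fix n and s :: "nat \<Rightarrow> nat" assume "strict_mono s"
    show "\<exists>r. strict_mono r \<and> P n (s \<circ> r)"
    proof (cases "from_nat n \<in> I")
      case True
      have "finite (range (\<lambda>k. a (from_nat n) (s k)))"
        by (rule finite_subset[OF _ assms[OF True]]) auto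
      then obtain k0 where "infinite {k. a (from_nat n) (s k) = a (from_nat n) (s k0)}"
        using pigeonhole_infinite[OF infinite_UNIV_nat] by auto
      from infinite_enumerate[OF this] show ?thesis by (auto simp: P_def)
    qed (auto simp: P_def intro!: exI[of _ id] strict_mono_id)
  qed
  have "\<exists>c. \<forall>\<^sub>F k in sequentially. a i (diagseq k) = c" if "i \<in> I" for i
  proof -
    have "P (to_nat i) (diagseq \<circ> (+) (Suc (to_nat i)))"
      by (rule diagseq_holds) (auto simp: P_def)
    then obtain c where c: "\<And>k. a i (diagseq (Suc (to_nat i) + k)) = c"
      using \<open>i \<in> I\<close> by (auto simp: P_def)
    have "a i (diagseq k) = c" if "k \<ge> Suc (to_nat i)" for k
      using c[of "k - Suc (to_nat i)"] that by simp
    then show ?thesis by (auto simp: eventually_sequentially)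
  qed
  then show ?thesis using subseq_diagseq by metis
qed

text \<open>
  Convergence edge by edge, without uniformity: all that the limit argument uses of convergence
  in norm, and unlike it directly visible at each nonzero edge.
\<close>

definition relabels_to :: "(nat \<Rightarrow> 'v \<Rightarrow> 'v) \<Rightarrow> 'v lgraph \<Rightarrow> 'v lgraph \<Rightarrow> bool" where
  "relabels_to F w' w \<longleftrightarrow> (\<forall>n. bij (F n)) \<and> (\<forall>e\<in>edges. (\<lambda>n. w' (F n ` e)) \<longlonglongrightarrow> w e)"

lemma relabels_to_subseq:
  "relabels_to F w' w \<Longrightarrow> strict_mono s \<Longrightarrow> relabels_to (F \<circ> s) w' w"
  unfolding relabels_to_def o_def
  by (intro conjI ballI allI) (auto intro: LIMSEQ_subseq_LIMSEQ[unfolded o_def])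

lemma relabels_toI:
  assumes "\<And>n. bij (F n)" "\<And>n. ldist w (relabel (F n) w') < ennreal (1 / Suc n)"
  shows "relabels_to F w' w"
  unfolding relabels_to_def
proof (intro conjI ballI allI assms(1))
  fix e :: "'a set" assume e: "e \<in> edges"
  have "norm (w' (F n ` e) - w e) \<le> 1 / Suc n" for n
    using order_le_less_trans[OF edge_diff_le_ldist[OF e, of w "relabel (F n) w'"] assms(2)] e
    by (simp add: ennreal_less_iff abs_minus_commute)
  then have "(\<lambda>n. w' (F n ` e) - w e) \<longlonglongrightarrow> 0"
    by (intro Lim_null_comparison[OF _ lim_inverse_n'[THEN LIMSEQ_Suc]]) auto
  then show "(\<lambda>n. w' (F n ` e)) \<longlonglongrightarrow> w e" by (simp add: LIM_zero_iff)
qed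

text \<open>
  A nonzero edge \<open>e\<close> at \<open>v\<close> is eventually carried to an edge of \<open>w'\<close> of weight above
  \<open>\<bar>w e\<bar> / 2\<close>; there are finitely many of these, with finitely many end points.
\<close>

lemma finite_range_of_nonisolated:
  assumes F: "relabels_to F w' w" and w': "w' \<in> fin_lgraphs" and v: "\<not> isolated w v"
  shows "finite (range (\<lambda>n. F n v))"
proof -
  obtain e where e: "e \<in> edges" "w e \<noteq> 0" "v \<in> e"
    using v by (auto simp: isolated_def)
  define H where "H = {e' \<in> edges. \<bar>w' e'\<bar> \<ge> \<bar>w e\<bar> / 2}"
  have "(\<lambda>n. \<bar>w' (F n ` e)\<bar>) \<longlonglongrightarrow> \<bar>w e\<bar>"
    using F e(1) by (auto simp: relabels_to_def intro: tendsto_rabs)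
  then have "\<forall>\<^sub>F n in sequentially. \<bar>w' (F n ` e)\<bar> > \<bar>w e\<bar> / 2"
    using e(2) by (intro order_tendstoD) auto
  then obtain N where N: "\<And>n. n \<ge> N \<Longrightarrow> \<bar>w' (F n ` e)\<bar> > \<bar>w e\<bar> / 2"
    by (auto simp: eventually_sequentially)
  have "F n v \<in> (\<lambda>n. F n v) ` {..<N} \<union> \<Union> H" for n
  proof (cases "n < N")
    case False
    have "F n ` e \<in> edges"
      using e(1) F by (simp add: image_in_edges_iff bij_is_inj relabels_to_def)
    with N[of n] False e(3) show ?thesis by (force simp: H_def)
  qed auto
  moreover have "finite H"
    unfolding H_def using w' e(2) by (intro finite_heavy_edges) auto
  then have "finite (\<Union> H)"
    by (rule finite_Union) (simp add: H_def edges_def card_ge_0_finite)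
  then have "finite ((\<lambda>n. F n v) ` {..<N} \<union> \<Union> H)" by simp
  ultimately show ?thesis by (metis finite_subset image_subsetI)
qed

text \<open>
  Once \<open>F n\<close> is stationary at both ends of the edge, the convergent sequence of weights
  \<open>w' (F n ` {u, v})\<close> is constant; and \<open>p \<noteq> q\<close> because a single injective \<open>F n\<close> takes both values.
\<close>

lemma limit_preserves_edge:
  assumes F: "relabels_to F w' w" and "u \<noteq> v"
    and "\<forall>\<^sub>F n in sequentially. F n u = p" "\<forall>\<^sub>F n in sequentially. F n v = q"
  shows "p \<noteq> q" "w' {p, q} = w {u, v}"
proof -
  have ev: "\<forall>\<^sub>F n in sequentially. F n u = p \<and> F n v = q"
    using assms(3,4) by (rule eventually_conj)
  then obtain n where "F n u = p" "F n v = q"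
    by (auto simp: eventually_sequentially)
  then show "p \<noteq> q"
    using F \<open>u \<noteq> v\<close> by (auto simp: relabels_to_def dest: bij_is_inj injD)
  have "(\<lambda>n. w' (F n ` {u, v})) \<longlonglongrightarrow> w {u, v}"
    using F \<open>u \<noteq> v\<close> unfolding relabels_to_def pair_in_edges[symmetric] by blast
  moreover have "(\<lambda>n. w' (F n ` {u, v})) \<longlonglongrightarrow> w' {p, q}"
    by (rule tendsto_eventually) (use ev in \<open>auto elim: eventually_mono\<close>)
  ultimately show "w' {p, q} = w {u, v}" using LIMSEQ_unique by blast
qed

text \<open>
  The other end point \<open>u\<close> of a nonzero edge at \<open>v\<close> is nonisolated too, so \<open>F n\<close> is stationary at
  both ends and the edge survives, with its weight, in the limit.
\<close>

lemma limit_preserves_nonisolated: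
  assumes F: "relabels_to F w' w"
    and f: "\<And>v. \<not> isolated w v \<Longrightarrow> \<forall>\<^sub>F n in sequentially. F n v = f v"
    and v: "\<not> isolated w v"
  shows "\<not> isolated w' (f v)"
proof -
  obtain e where e: "e \<in> edges" "w e \<noteq> 0" "v \<in> e"
    using v by (auto simp: isolated_def)
  then obtain u where u: "e = {v, u}" "u \<noteq> v" by (blast elim: edgeE)
  have "\<not> isolated w u" using e u by (auto simp: isolated_def)
  from limit_preserves_edge[OF F u(2)[symmetric] f[OF v] f[OF this]] e(2) u(1)
  have "{f v, f u} \<in> edges" "w' {f v, f u} \<noteq> 0" by (simp_all add: pair_in_edges)
  then show ?thesis unfolding isolated_def by blast
qed

text \<open>
  The sets of isolated vertices are both countably infinite, hence in bijection, and it does not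
  matter which bijection is taken, since an edge with an isolated end point has weight \<open>0\<close> on
  either side. With finitely many isolated vertices such an extension may not exist.
\<close>

lemma iso_of_nonisolated_bij:
  fixes w w' :: "'v::{countable,infinite} lgraph"
  assumes w: "w \<in> std_lgraphs" "w' \<in> std_lgraphs"
    and f: "bij_betw f {v. \<not> isolated w v} {v. \<not> isolated w' v}"
    and pres: "\<And>u v. u \<noteq> v \<Longrightarrow> \<not> isolated w u \<Longrightarrow> \<not> isolated w v \<Longrightarrow> w' {f u, f v} = w {u, v}"
  shows "(w, w') \<in> iso_rel"
proof -
  have inf: "infinite {v. isolated w v}" "infinite {v. isolated w' v}"
    using w by (auto simp: std_lgraphs_def)
  obtain h where h: "bij_betw h {v. isolated w v} {v. isolated w' v}"
    using bij_betw_trans[OF to_nat_on_infinite[OF _ inf(1)] bij_betw_from_nat_into[OF _ inf(2)]]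
    by (metis countableI_type)
  define k where "k v = (if isolated w v then h v else f v)" for v
  have iso_k: "isolated w' (k v)" if "isolated w v" for v
    using bij_betwE[OF h] that by (auto simp: k_def)
  have "bij_betw k ({v. isolated w v} \<union> {v. \<not> isolated w v}) ({v. isolated w' v} \<union> {v. \<not> isolated w' v})"
  proof (rule bij_betw_combine)
    show "bij_betw k {v. isolated w v} {v. isolated w' v}"
      using h by (subst bij_betw_cong[where g = h]) (auto simp: k_def)
    show "bij_betw k {v. \<not> isolated w v} {v. \<not> isolated w' v}"
      using f by (subst bij_betw_cong[where g = f]) (auto simp: k_def)
  qed auto
  moreover have "{v. isolated w v} \<union> {v. \<not> isolated w v} = UNIV"
    "{v. isolated w' v} \<union> {v. \<not> isolated w' v} = UNIV" by auto
  ultimately have k: "bij k" by simp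
  have "w {u, v} = w' {k u, k v}" if "u \<noteq> v" for u v
  proof (cases "isolated w u \<or> isolated w v")
    case True
    have "k u \<noteq> k v" using k that by (auto dest: bij_is_inj injD)
    moreover have "isolated w' (k u) \<or> isolated w' (k v)" using True iso_k by blast
    ultimately have "w' {k u, k v} = 0" "w {u, v} = 0"
      using True that by (auto simp: isolated_def pair_in_edges)
    then show ?thesis by simp
  next
    case False
    then show ?thesis using pres[OF that] by (simp add: k_def)
  qed
  then show ?thesis
    using w k by (auto simp: iso_rel_def std_lgraphs_def pair_in_edges)
qed

text \<open>
  Besides the limits \<open>f\<close> of \<open>F n\<close> on the nonisolated vertices of \<open>w\<close>, the limits \<open>g\<close> of the
  inverses are needed: those of \<open>F n\<close> alone embed the nonzero part of \<open>w\<close> into that of \<open>w'\<close>,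
  but do not show that the embedding is onto.
\<close>

lemma iso_rel_if_udist_0:
  fixes w w' :: "'v::{countable,infinite} lgraph"
  assumes w: "w \<in> fin_std_lgraphs" and w': "w' \<in> fin_std_lgraphs"
    and "udist (iso_class w) (iso_class w') = 0"
  shows "(w, w') \<in> iso_rel"
proof -
  have L: "w \<in> lgraphs" "w' \<in> lgraphs" "w \<in> fin_lgraphs" "w' \<in> fin_lgraphs"
    "w \<in> std_lgraphs" "w' \<in> std_lgraphs"
    using w w' by (auto simp: fin_std_lgraphs_def fin_lgraphs_def)
  have "\<exists>f. bij f \<and> ldist w (relabel f w') < ennreal (1 / Suc n)" for n
  proof -
    have "(INF f\<in>{f. bij f}. ldist w (relabel f w')) < ennreal (1 / Suc n)"
      using assms(3) L by (simp add: udist_iso_class)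
    then show ?thesis by (simp add: INF_less_iff)
  qed
  then obtain F where F: "\<And>n. bij (F n)" "\<And>n. ldist w (relabel (F n) w') < ennreal (1 / Suc n)"
    by metis
  have forward: "relabels_to F w' w" using F by (rule relabels_toI)
  have backward: "relabels_to (\<lambda>n. inv (F n)) w w'"
    using F L by (intro relabels_toI) (auto simp: bij_imp_bij_inv ldist_relabel_inv)
  \<comment> \<open>The sum type makes a single diagonal argument cover both directions, so that \<open>f\<close> and \<open>g\<close>
    arise along the same subsequence and can be compared.\<close>
  define a :: "'v + 'v \<Rightarrow> nat \<Rightarrow> 'v" where "a = case_sum (\<lambda>v n. F n v) (\<lambda>v n. inv (F n) v)"
  have "finite (range (a i))" if "i \<in> {v. \<not> isolated w v} <+> {v. \<not> isolated w' v}" for i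
    using that
  proof (rule PlusE)
    fix v assume "v \<in> {v. \<not> isolated w v}" "i = Inl v"
    then show ?thesis
      using finite_range_of_nonisolated[OF forward L(4), of v] by (simp add: a_def)
  next
    fix v assume "v \<in> {v. \<not> isolated w' v}" "i = Inr v"
    then show ?thesis
      using finite_range_of_nonisolated[OF backward L(3), of v] by (simp add: a_def)
  qed
  then obtain s c where s: "strict_mono s"
    and c: "\<forall>i \<in> {v. \<not> isolated w v} <+> {v. \<not> isolated w' v}.
        \<forall>\<^sub>F k in sequentially. a i (s k) = c i"
    using diagonal_eventually_constant[of _ a] by meson
  define f g where "f v = c (Inl v)" and "g v = c (Inr v)" for v
  define G where "G = F \<circ> s"
  have forward: "relabels_to G w' w" and backward: "relabels_to (\<lambda>n. inv (G n)) w w'"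
    using relabels_to_subseq[OF forward s] relabels_to_subseq[OF backward s] by (simp_all add: G_def o_def)
  have f: "\<forall>\<^sub>F n in sequentially. G n v = f v" if "\<not> isolated w v" for v
    using bspec[OF c InlI, of v] that by (simp add: G_def a_def f_def)
  have g: "\<forall>\<^sub>F n in sequentially. inv (G n) v = g v" if "\<not> isolated w' v" for v
    using bspec[OF c InrI, of v] that by (simp add: G_def a_def g_def)
  have fN: "\<not> isolated w' (f v)" if "\<not> isolated w v" for v
    using limit_preserves_nonisolated[OF forward f that] .
  have gN: "\<not> isolated w (g v)" if "\<not> isolated w' v" for v
    using limit_preserves_nonisolated[OF backward g that] .
  have bij: "bij (G n)" for n using F by (simp add: G_def)
  \<comment> \<open>At one late index both limits have been reached, so \<open>g\<close> inverts \<open>f\<close> because \<open>inv (G n)\<close>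
    inverts \<open>G n\<close>.\<close>
  have gf: "g (f v) = v" if "\<not> isolated w v" for v
  proof -
    have "\<forall>\<^sub>F n in sequentially. G n v = f v \<and> inv (G n) (f v) = g (f v)"
      using f[OF that] g[OF fN[OF that]] by (rule eventually_conj)
    then obtain n where "G n v = f v" "inv (G n) (f v) = g (f v)"
      by (auto simp: eventually_sequentially)
    then show ?thesis using bij[of n] by (metis bij_inv_eq_iff)
  qed
  have fg: "f (g v) = v" if "\<not> isolated w' v" for v
  proof -
    have "\<forall>\<^sub>F n in sequentially. inv (G n) v = g v \<and> G n (g v) = f (g v)"
      using g[OF that] f[OF gN[OF that]] by (rule eventually_conj)
    then obtain n where "inv (G n) v = g v" "G n (g v) = f (g v)"
      by (auto simp: eventually_sequentially)
    then show ?thesis using bij[of n] by (metis bij_inv_eq_iff)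
  qed
  have "bij_betw f {v. \<not> isolated w v} {v. \<not> isolated w' v}"
    by (rule bij_betw_byWitness[where f' = g]) (use gf fg fN gN in auto)
  moreover have "w' {f u, f v} = w {u, v}"
    if "u \<noteq> v" "\<not> isolated w u" "\<not> isolated w v" for u v
    using limit_preserves_edge(2)[OF forward that(1) f[OF that(2)] f[OF that(3)]] .
  ultimately show ?thesis
    using L by (intro iso_of_nonisolated_bij) auto
qed

section \<open>The metric\<close>

theorem theorem1:
  "(\<forall>w \<in> fin_std_lgraphs. \<forall>w' \<in> (fin_std_lgraphs :: 'v::{countable,infinite} lgraph set).
      udist (iso_class w) (iso_class w') = 0 \<longrightarrow> iso_class w = iso_class w') \<and>
   (\<forall>G \<in> fin_ugraphs. \<forall>G' \<in> (fin_ugraphs :: 'v lgraph set set). udist G G' < \<infinity>) \<and>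
   Metric_space (fin_ugraphs :: 'v lgraph set set) (\<lambda>G G'. enn2real (udist G G'))"
proof (intro conjI)
  have zero: "iso_class w = iso_class w'"
    if "w \<in> fin_std_lgraphs" "w' \<in> fin_std_lgraphs" "udist (iso_class w) (iso_class w') = 0"
    for w w' :: "'v lgraph"
    unfolding iso_class_def
    by (rule equiv_class_eq[OF equiv_iso_rel iso_rel_if_udist_0[OF that]])
  then show "\<forall>w \<in> fin_std_lgraphs. \<forall>w' \<in> (fin_std_lgraphs :: 'v lgraph set).
      udist (iso_class w) (iso_class w') = 0 \<longrightarrow> iso_class w = iso_class w'" by blast
  have rep: "\<exists>w \<in> fin_std_lgraphs. G = iso_class w" if "G \<in> fin_ugraphs" for G :: "'v lgraph set"
    using that by (auto simp: fin_ugraphs_def iso_class_def quotient_def)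
  have fin: "udist G G' < \<infinity>" if "G \<in> fin_ugraphs" "G' \<in> fin_ugraphs" for G G' :: "'v lgraph set"
    using rep[OF that(1)] rep[OF that(2)] udist_finite by (auto simp: fin_std_lgraphs_def)
  then show "\<forall>G \<in> fin_ugraphs. \<forall>G' \<in> (fin_ugraphs :: 'v lgraph set set). udist G G' < \<infinity>" by blast
  show "Metric_space (fin_ugraphs :: 'v lgraph set set) (\<lambda>G G'. enn2real (udist G G'))"
  proof
    fix G G' :: "'v lgraph set"
    show "0 \<le> enn2real (udist G G')" by simp
    show "enn2real (udist G G') = enn2real (udist G' G)" by (simp add: udist_commute)
  next
    fix G G' :: "'v lgraph set"
    assume G: "G \<in> fin_ugraphs" "G' \<in> fin_ugraphs"
    then obtain w w' where w: "w \<in> fin_std_lgraphs" "G = iso_class w"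
      and w': "w' \<in> fin_std_lgraphs" "G' = iso_class w'"
      using rep by metis
    have "enn2real (udist G G') = 0 \<longleftrightarrow> udist G G' = 0"
      using fin[OF G] by (auto simp: enn2real_eq_0_iff)
    also have "\<dots> \<longleftrightarrow> G = G'"
      using zero w w' udist_self by (auto simp: fin_std_lgraphs_def fin_lgraphs_def)
    finally show "enn2real (udist G G') = 0 \<longleftrightarrow> G = G'" .
  next
    fix G G' G'' :: "'v lgraph set"
    assume G: "G \<in> fin_ugraphs" "G' \<in> fin_ugraphs" "G'' \<in> fin_ugraphs"
    then have "udist G G'' \<le> udist G G' + udist G' G''"
      using rep[OF G(1)] rep[OF G(2)] rep[OF G(3)] udist_triangle
      by (auto simp: fin_std_lgraphs_def fin_lgraphs_def)
    then have "enn2real (udist G G'') \<le> enn2real (udist G G' + udist G' G'')"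
      using fin G by (intro enn2real_mono) auto
    also have "\<dots> = enn2real (udist G G') + enn2real (udist G' G'')"
      using fin G by (intro enn2real_plus) auto
    finally show "enn2real (udist G G'') \<le> enn2real (udist G G') + enn2real (udist G' G'')" .
  qed
qed

end
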